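(* For any integer $k\ge2$ and any outerplanar graph $G$ with maximum degree $\Delta(G)\ge3$, we have $\chi_k(G)\le\mathit{ch}_k(G)\le\bigl\lfloor\frac{\Delta(G)-1}{k}\bigr\rfloor+3$.
   Context: All graphs are finite and simple. An outerplanar graph is a graph that can be drawn in the plane so that all vertices lie on the outer face. For an integer $k\ge1$, a $k$-frugal colouring of $G$ is a proper vertex colouring such that no colour appears more than $k$ times in the neighbourhood of any vertex; $\chi_k(G)$ is the least number of colours in a $k$-frugal colouring. A $t$-list assignment $L$ assigns to each vertex $v$ a list $L(v)$ of $t$ integers; $\mathit{ch}_k(G)$ is the least $t$ such that for every $t$-list assignment $L$ there is a $k$-frugal colouring with each vertex $v$ coloured from $L(v)$. *)

theory Defs
  imports "HOL-Analysis.Analysis"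
begin

definition fin_simple_graph :: "'a set \<Rightarrow> 'a set set \<Rightarrow> bool" where
  "fin_simple_graph V E \<longleftrightarrow> finite V \<and> (\<forall>e\<in>E. e \<subseteq> V \<and> card e = 2)"

definition neighbourhood :: "'a set set \<Rightarrow> 'a \<Rightarrow> 'a set" where
  "neighbourhood E v = {u. {u, v} \<in> E}"

definition degree :: "'a set set \<Rightarrow> 'a \<Rightarrow> nat" where
  "degree E v = card (neighbourhood E v)"

(* The inserted 0 only fixes the value for the graph without vertices. *)
definition max_degree :: "'a set \<Rightarrow> 'a set set \<Rightarrow> nat" where
  "max_degree V E = Max (insert 0 (degree E ` V))"

definition plane_drawing ::
    "'a set \<Rightarrow> 'a set set \<Rightarrow> ('a \<Rightarrow> complex) \<Rightarrow> ('a set \<Rightarrow> real \<Rightarrow> complex) \<Rightarrow> bool" where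
  "plane_drawing V E p \<gamma> \<longleftrightarrow>
     inj_on p V \<and>
     (\<forall>e\<in>E. arc (\<gamma> e) \<and> {pathstart (\<gamma> e), pathfinish (\<gamma> e)} = p ` e
            \<and> path_image (\<gamma> e) \<inter> p ` V = p ` e) \<and>
     (\<forall>e\<in>E. \<forall>f\<in>E. e \<noteq> f \<longrightarrow> path_image (\<gamma> e) \<inter> path_image (\<gamma> f) \<subseteq> p ` (e \<inter> f))"

definition drawing_image ::
    "'a set \<Rightarrow> 'a set set \<Rightarrow> ('a \<Rightarrow> complex) \<Rightarrow> ('a set \<Rightarrow> real \<Rightarrow> complex) \<Rightarrow> complex set" where
  "drawing_image V E p \<gamma> = p ` V \<union> (\<Union>e\<in>E. path_image (\<gamma> e))"

(* The image of a drawing of a finite graph is compact, so its outside is exactly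
   the one unbounded face; a vertex lies on that face if it is on its boundary. *)
definition outerplanar :: "'a set \<Rightarrow> 'a set set \<Rightarrow> bool" where
  "outerplanar V E \<longleftrightarrow>
     (\<exists>p \<gamma>. plane_drawing V E p \<gamma> \<and> p ` V \<subseteq> frontier (outside (drawing_image V E p \<gamma>)))"

definition frugal_colouring :: "nat \<Rightarrow> 'a set \<Rightarrow> 'a set set \<Rightarrow> ('a \<Rightarrow> int) \<Rightarrow> bool" where
  "frugal_colouring k V E c \<longleftrightarrow>
     (\<forall>u v. {u, v} \<in> E \<longrightarrow> c u \<noteq> c v) \<and>
     (\<forall>v\<in>V. \<forall>a. card {u \<in> neighbourhood E v. c u = a} \<le> k)"

definition frugal_chromatic_number :: "nat \<Rightarrow> 'a set \<Rightarrow> 'a set set \<Rightarrow> nat" where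
  "frugal_chromatic_number k V E =
     (LEAST n. \<exists>c. frugal_colouring k V E c \<and> card (c ` V) = n)"

definition list_assignment :: "nat \<Rightarrow> 'a set \<Rightarrow> ('a \<Rightarrow> int set) \<Rightarrow> bool" where
  "list_assignment t V L \<longleftrightarrow> (\<forall>v\<in>V. finite (L v) \<and> card (L v) = t)"

definition frugal_choosable :: "nat \<Rightarrow> 'a set \<Rightarrow> 'a set set \<Rightarrow> nat \<Rightarrow> bool" where
  "frugal_choosable k V E t \<longleftrightarrow>
     (\<forall>L. list_assignment t V L \<longrightarrow> (\<exists>c. frugal_colouring k V E c \<and> (\<forall>v\<in>V. c v \<in> L v)))"

definition frugal_choice_number :: "nat \<Rightarrow> 'a set \<Rightarrow> 'a set set \<Rightarrow> nat" where
  "frugal_choice_number k V E = (LEAST t. frugal_choosable k V E t)"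

lemma inj_frugal_colouring:
  assumes G: "fin_simple_graph V E" and "k \<ge> 1" and c: "inj_on c V"
  shows "frugal_colouring k V E c"
proof -
  have sub: "u \<in> V \<and> v \<in> V \<and> u \<noteq> v" if "{u, v} \<in> E" for u v
    using G that unfolding fin_simple_graph_def by (cases "u = v") fastforce+
  have "card {u \<in> neighbourhood E v. c u = a} \<le> k" for v a
  proof -
    have "\<exists>w. {u \<in> neighbourhood E v. c u = a} \<subseteq> {w}"
      using sub c unfolding neighbourhood_def inj_on_def by blast
    then obtain w where "{u \<in> neighbourhood E v. c u = a} \<subseteq> {w}" by blast
    from card_mono[OF _ this] show ?thesis using \<open>k \<ge> 1\<close> by simp
  qed
  moreover have "c u \<noteq> c v" if "{u, v} \<in> E" for u v
    using sub[OF that] c by (auto simp: inj_on_def)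
  ultimately show ?thesis by (auto simp: frugal_colouring_def)
qed

(* Both minima above range over nonempty sets. *)
lemma frugal_choosable_card:
  assumes G: "fin_simple_graph V E" and k: "k \<ge> 1"
  shows "frugal_choosable k V E (card V)"
  unfolding frugal_choosable_def list_assignment_def
proof (intro allI impI)
  fix L :: "'a \<Rightarrow> int set"
  assume L: "\<forall>v\<in>V. finite (L v) \<and> card (L v) = card V"
  have fin: "finite V" using G by (simp add: fin_simple_graph_def)
  have "\<exists>c. inj_on c W \<and> (\<forall>v\<in>W. c v \<in> L v)" if "W \<subseteq> V" for W
    using finite_subset[OF that fin] that
  proof (induction W rule: finite_induct)
    case (insert x W)
    then obtain c where c: "inj_on c W" "\<forall>v\<in>W. c v \<in> L v" by auto
    have "card (c ` W) \<le> card W" using insert.hyps by (simp add: card_image_le)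
    also have "card W < card V"
      using insert fin by (intro psubset_card_mono) auto
    also have "card V = card (L x)" using L insert.prems by auto
    finally have "\<not> L x \<subseteq> c ` W" using insert.hyps by (meson card_mono finite_imageI not_le)
    then obtain a where "a \<in> L x" "a \<notin> c ` W" by auto
    moreover have "inj_on (c(x := a)) (insert x W)"
      using c \<open>a \<notin> c ` W\<close> insert.hyps by (auto simp: inj_on_def)
    moreover have "\<forall>v\<in>insert x W. (c(x := a)) v \<in> L v"
      using c(2) \<open>a \<in> L x\<close> by simp
    ultimately show ?case by blast
  qed auto
  then obtain c where "inj_on c V" "\<forall>v\<in>V. c v \<in> L v" by blast
  then show "\<exists>c. frugal_colouring k V E c \<and> (\<forall>v\<in>V. c v \<in> L v)"
    using inj_frugal_colouring[OF G k] by blast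
qed

lemma frugal_colouring_exists:
  assumes "fin_simple_graph V E" and "k \<ge> 1"
  shows "\<exists>c. frugal_colouring k V E c"
proof -
  obtain f :: "'a \<Rightarrow> nat" where "inj_on f V"
    using assms(1) finite_imp_inj_to_nat_seg unfolding fin_simple_graph_def by metis
  then have "inj_on (\<lambda>v. int (f v)) V" by (auto simp: inj_on_def)
  then show ?thesis using inj_frugal_colouring[OF assms] by blast
qed

end

theory Submission
  imports Defs
begin

text \<open>In a drawing with all vertices on the outer face, no vertex lies inside a cycle. One of three
  internally disjoint arcs with common ends always lies inside the cycle of the other two; hence there
  are no three internally disjoint paths with inner vertices between two vertices, and no cycle has
  two crossing chords. Splitting at cut vertices, and taking a longest cycle (which is then
  Hamiltonian) in the remaining case, the vertices can be placed on a line so that no two edges drawn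
  above it cross. Such a graph has a vertex \<open>u\<close> whose neighbours are among two vertices \<open>v\<close>, \<open>w\<close>,
  where \<open>v\<close> has its neighbours other than \<open>u\<close> and \<open>w\<close> pairwise adjacent. Colouring greedily, \<open>u\<close>
  has to avoid only the colours of \<open>v\<close> and \<open>w\<close> and the at most \<open>(\<Delta> - 1) div k\<close> colours already
  used \<open>k\<close> times around \<open>w\<close>.\<close>

section \<open>Theta curves and crossing arcs\<close>

text \<open>The two arcs are kept apart instead of being merged into one closed path, so that any
  two of the three arcs of a theta curve can be paired.\<close>

locale two_arcs =
  fixes g h :: "real \<Rightarrow> complex" and a b :: complex
  assumes arcs: "arc g" "arc h"
    and ends: "pathstart g = a" "pathfinish g = b" "pathstart h = a" "pathfinish h = b"
    and Int: "path_image g \<inter> path_image h = {a, b}"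
begin

abbreviation "curve \<equiv> path_image g \<union> path_image h"

text \<open>Jordan curve theorem for \<open>g\<close> followed by the reversal of
  \<open>h\<close>.\<close>

lemma Jordan:
  "inside curve \<noteq> {}" "open (inside curve)" "connected (inside curve)"
  "connected (outside curve)" "frontier (inside curve) = curve" "compact curve"
proof -
  have "simple_path (g +++ reversepath h)"
    using arcs ends Int by (intro simple_path_join_loop) (auto simp: arc_reversepath)
  moreover have "pathfinish (g +++ reversepath h) = pathstart (g +++ reversepath h)"
    using ends by simp
  moreover have "path_image (g +++ reversepath h) = curve"
    using ends by (simp add: path_image_join)
  ultimately show "inside curve \<noteq> {}" "open (inside curve)" "connected (inside curve)"
    "connected (outside curve)" "frontier (inside curve) = curve"
    using Jordan_inside_outside by metis+
  show "compact curve" using arcs by (simp add: compact_Un compact_arc_image)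
qed

text \<open>To leave the inside, a connected set would have to meet its frontier, which is
  \<open>curve\<close>.\<close>

lemma connected_subset_inside:
  assumes "connected S" "S \<inter> curve = {}" "S \<inter> inside curve \<noteq> {}"
  shows "S \<subseteq> inside curve"
  using connected_Int_frontier[of S "inside curve"] assms Jordan(5) by blast

lemma closure_inside: "closure (inside curve) = inside curve \<union> curve"
  using Jordan(5) closure_Un_frontier by metis

end

lemma arc_endless:
  assumes "arc g"
  shows "connected (path_image g - {pathstart g, pathfinish g})"
    and "path_image g \<subseteq> closure (path_image g - {pathstart g, pathfinish g})"
proof -
  have s: "simple_path g" using assms arc_imp_simple_path by blast
  show "connected (path_image g - {pathstart g, pathfinish g})"
    using s connected_simple_path_endless by blast
  have "path_image g - {pathstart g, pathfinish g} = g ` {0<..<1}"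
    using s simple_path_endless by auto
  \<comment> \<open>\<open>g\<close> is continuous on the closed unit interval, which is the closure
    of the open one.\<close>
  moreover have "g ` closure {0<..<1} \<subseteq> closure (g ` {0<..<1})"
    using assms by (intro image_closure_subset) (auto simp: arc_def path_def closure_subset)
  ultimately show "path_image g \<subseteq> closure (path_image g - {pathstart g, pathfinish g})"
    by (simp add: path_image_def)
qed

text \<open>The inside of the cycle of \<open>g\<close> and \<open>h\<close> is connected and misses
  the cycle of \<open>g\<close> and \<open>k\<close>, so it lies inside the latter; taking closures
  carries \<open>h\<close> along.\<close>

lemma theta_inside_aux:
  assumes "two_arcs g h a b" "two_arcs g k a b" "two_arcs h k a b"
    and "path_image k \<inter> inside (path_image g \<union> path_image h) = {}"
    and "inside (path_image g \<union> path_image h) \<inter> inside (path_image g \<union> path_image k) \<noteq> {}"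
  shows "path_image h - {a, b} \<subseteq> inside (path_image g \<union> path_image k)"
proof -
  interpret gh: two_arcs g h a b by fact
  interpret gk: two_arcs g k a b by fact
  interpret hk: two_arcs h k a b by fact
  have "inside gh.curve \<inter> gk.curve = {}" using assms(4) inside_no_overlap[of gh.curve] by blast
  then have "inside gh.curve \<subseteq> inside gk.curve"
    using assms(5) gh.Jordan(3) by (intro gk.connected_subset_inside)
  then have "gh.curve \<subseteq> inside gk.curve \<union> gk.curve"
    using closure_mono gh.closure_inside gk.closure_inside by blast
  then show ?thesis using gh.Int hk.Int by blast
qed

text \<open>If the third arc misses the inside of the first two, a point of that inside would otherwise be
  outside both other cycles; these share a connected set, so by Janiszewski's theorem the point could
  be joined to infinity.\<close>

lemma theta_inside:
  assumes "two_arcs g h a b" "two_arcs g k a b" "two_arcs h k a b"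
  obtains "path_image g - {a, b} \<subseteq> inside (path_image h \<union> path_image k)"
  | "path_image h - {a, b} \<subseteq> inside (path_image g \<union> path_image k)"
  | "path_image k - {a, b} \<subseteq> inside (path_image g \<union> path_image h)"
proof -
  interpret gh: two_arcs g h a b by fact
  interpret gk: two_arcs g k a b by fact
  interpret hk: two_arcs h k a b by fact
  show ?thesis
  proof (cases "path_image k \<inter> inside gh.curve = {}")
    case False
    \<comment> \<open>Once \<open>k\<close> enters this inside it stays there: without its ends it
      is connected and avoids both other arcs.\<close>
    then have "(path_image k - {a, b}) \<inter> inside gh.curve \<noteq> {}"
      using inside_no_overlap[of gh.curve] gh.Int by blast
    moreover have "connected (path_image k - {a, b})"
      using arc_endless(1)[OF gk.arcs(2)] gk.ends by simp
    ultimately have "path_image k - {a, b} \<subseteq> inside gh.curve"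
      using gk.Int hk.Int by (intro gh.connected_subset_inside) auto
    then show ?thesis using that by blast
  next
    case True
    have "bounded (gh.curve \<union> path_image k)"
      using gh.arcs gk.arcs by (simp add: bounded_arc_image)
    \<comment> \<open>\<open>y\<close> stands for infinity: it is outside all three cycles.\<close>
    then obtain y where y: "y \<in> outside (gh.curve \<union> path_image k)"
      using outside_bounded_nonempty by blast
    obtain x where x: "x \<in> inside gh.curve" using gh.Jordan(1) by blast
    have xn: "x \<notin> gh.curve" "x \<notin> path_image k" using x True inside_no_overlap by blast+
    have "x \<in> inside gk.curve \<or> x \<in> inside hk.curve"
    proof (rule ccontr)
      assume *: "\<not> ?thesis"
      have "x \<in> outside gk.curve" "x \<in> outside hk.curve"
        using * xn inside_Un_outside[of gk.curve] inside_Un_outside[of hk.curve] by blast+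
      moreover have "y \<in> outside gk.curve" "y \<in> outside hk.curve" "y \<in> outside gh.curve"
        using y outside_mono[of _ "gh.curve \<union> path_image k"] by blast+
      ultimately have "connected_component (- gk.curve) x y" "connected_component (- hk.curve) x y"
        using gk.Jordan(4) hk.Jordan(4) outside_no_overlap unfolding connected_component_def
        by (metis Compl_disjoint2 disjoint_eq_subset_Compl inf.commute)+
      moreover have "gk.curve \<inter> hk.curve = path_image k"
        using gh.Int gk.Int by blast
      then have "connected (gk.curve \<inter> hk.curve)"
        using gk.arcs(2) by (simp add: connected_arc_image)
      ultimately have "connected_component (- (gk.curve \<union> hk.curve)) x y"
        using Janiszewski[OF gk.Jordan(6) compact_imp_closed[OF hk.Jordan(6)]] by blast
      then have "connected_component (- gh.curve) x y"
        by (rule connected_component_of_subset) auto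
      then have "y \<in> inside gh.curve"
        using x inside_same_component by blast
      then show False using \<open>y \<in> outside gh.curve\<close> by (metis disjoint_iff inside_Int_outside)
    qed
    then show ?thesis
    proof
      assume "x \<in> inside gk.curve"
      then have "path_image h - {a, b} \<subseteq> inside gk.curve"
        using x True by (intro theta_inside_aux assms) auto
      then show ?thesis using that by blast
    next
      assume "x \<in> inside hk.curve"
      moreover have "two_arcs h g a b"
        using gh.two_arcs_axioms unfolding two_arcs_def by (simp add: Int_commute)
      ultimately have "path_image g - {a, b} \<subseteq> inside hk.curve"
        using x True by (intro theta_inside_aux assms) (auto simp: Un_commute)
      then show ?thesis using that by blast
    qed
  qed
qed

text \<open>The arc \<open>k\<close> cuts the inside of the cycle of \<open>g\<close> and
  \<open>h\<close> into two regions. Without its ends \<open>q\<close> is connected, so it runs in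
  just one of them, and the end of \<open>q\<close> that is off the boundary of this region must lie
  in the region. When the arcs are made of edges of an outerplane drawing and \<open>c\<close>,
  \<open>d\<close> are vertices, both outcomes are absurd.\<close>

lemma crossing_arcs_inside:
  assumes gh: "two_arcs g h a b" and gk: "two_arcs g k a b" and hk: "two_arcs h k a b"
    and k: "path_image k - {a, b} \<subseteq> inside (path_image g \<union> path_image h)"
    and q: "arc q" "pathstart q = c" "pathfinish q = d"
    and q_in: "path_image q - {c, d} \<subseteq> inside (path_image g \<union> path_image h)"
    and disj: "path_image q \<inter> path_image k = {}"
    and c: "c \<in> path_image g" and d: "d \<in> path_image h"
  obtains "d \<in> inside (path_image g \<union> path_image k)" | "c \<in> inside (path_image h \<union> path_image k)"
proof -
  interpret gh: two_arcs g h a b by fact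
  interpret gk: two_arcs g k a b by fact
  interpret hk: two_arcs h k a b by fact
  let ?Q = "path_image q - {c, d}"
  note sp = arc_imp_simple_path
  have "a \<noteq> b" using gh.arcs gh.ends arc_distinct_ends by metis
  moreover have "path_image k - {a, b} \<noteq> {}"
    using nonempty_simple_path_endless[OF sp[OF gk.arcs(2)]] gk.ends by simp
  then have "path_image k \<inter> inside gh.curve \<noteq> {}" using k by blast
  ultimately have split: "inside gk.curve \<union> inside hk.curve \<union> (path_image k - {a, b}) = inside gh.curve"
    by (rule split_inside_simple_closed_curve[OF sp[OF gh.arcs(1)] gh.ends(1,2)
      sp[OF gh.arcs(2)] gh.ends(3,4) sp[OF gk.arcs(2)] gk.ends(3,4) _ gh.Int gk.Int hk.Int])
  have "c \<notin> path_image k" "d \<notin> path_image k"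
    using disj q pathstart_in_path_image pathfinish_in_path_image by blast+
  then have cd: "c \<notin> path_image h" "d \<notin> path_image g"
    using c d gh.Int gk.Int hk.Int by blast+
  have con: "connected ?Q" and cl: "c \<in> closure ?Q" "d \<in> closure ?Q"
    using arc_endless[OF q(1)] q pathstart_in_path_image[of q] pathfinish_in_path_image[of q] by auto
  have Q: "?Q \<inter> gh.curve = {}" using q_in inside_no_overlap by blast
  have "?Q \<noteq> {}" using nonempty_simple_path_endless[OF sp[OF q(1)]] q by simp
  then consider "?Q \<inter> inside gk.curve \<noteq> {}" | "?Q \<inter> inside hk.curve \<noteq> {}"
    using split q_in disj by blast
  then show ?thesis
  proof cases
    case 1
    then have "?Q \<subseteq> inside gk.curve"
      using con Q disj by (intro gk.connected_subset_inside) auto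
    then have "d \<in> inside gk.curve \<union> gk.curve"
      using cl closure_mono gk.closure_inside by blast
    then show ?thesis using that cd \<open>d \<notin> path_image k\<close> by blast
  next
    case 2
    then have "?Q \<subseteq> inside hk.curve"
      using con Q disj by (intro hk.connected_subset_inside) auto
    then have "c \<in> inside hk.curve \<union> hk.curve"
      using cl closure_mono hk.closure_inside by blast
    then show ?thesis using that cd \<open>c \<notin> path_image k\<close> by blast
  qed
qed

section \<open>Outerplane drawings\<close>

text \<open>The list holds only the inner vertices of the walk.\<close>

fun walk_edges :: "'a \<Rightarrow> 'a list \<Rightarrow> 'a \<Rightarrow> 'a set set" where
  "walk_edges x [] y = {{x, y}}"
| "walk_edges x (z # A) y = insert {x, z} (walk_edges z A y)"

lemma walk_edges_append: "walk_edges x (A @ y # B) z = walk_edges x A y \<union> walk_edges y B z"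
  by (induction A arbitrary: x) auto

lemma walk_edges_rev: "walk_edges x (rev A) y = walk_edges y A x"
  by (induction A arbitrary: y) (auto simp: walk_edges_append insert_commute)

lemma Union_walk_edges: "\<Union> (walk_edges x A y) = {x, y} \<union> set A"
  by (induction A arbitrary: x) auto

text \<open>This makes internally disjoint walks edge-disjoint as soon as one of them has an inner
  vertex.\<close>

lemma walk_edges_meets: "e \<in> walk_edges x A y \<Longrightarrow> A \<noteq> [] \<Longrightarrow> e \<inter> set A \<noteq> {}"
proof (induction A arbitrary: x)
  case (Cons z A)
  then show ?case by (cases "A = []") auto
qed simp

text \<open>The excluded graphs are the subdivisions of \<open>K_{2,3}\<close>, with
  \<open>a\<close> and \<open>b\<close> as the vertices of degree 3.\<close>

definition theta_free :: "'a set set \<Rightarrow> bool" where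
  "theta_free E \<longleftrightarrow> (\<forall>a b P Q R. distinct (a # b # P @ Q @ R) \<longrightarrow> P \<noteq> [] \<longrightarrow> Q \<noteq> [] \<longrightarrow> R \<noteq> [] \<longrightarrow>
     \<not> walk_edges a P b \<union> walk_edges a Q b \<union> walk_edges a R b \<subseteq> E)"

text \<open>The excluded graphs are subdivisions of \<open>K_4\<close> in which the two disjoint
  edges \<open>{a, c}\<close> and \<open>{b, d}\<close> stay undivided; each of the lists
  \<open>A\<close>, \<open>B\<close>, \<open>C\<close>, \<open>D\<close> may be empty.\<close>

definition crossing_free :: "'a set set \<Rightarrow> bool" where
  "crossing_free E \<longleftrightarrow> (\<forall>a b c d A B C D. distinct (a # b # c # d # A @ B @ C @ D) \<longrightarrow>
     walk_edges a A b \<union> walk_edges b B c \<union> walk_edges c C d \<union> walk_edges d D a \<subseteq> E \<longrightarrow>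
     \<not> {{a, c}, {b, d}} \<subseteq> E)"

locale outerplane_drawing =
  fixes V :: "'a set" and E and p and \<gamma>
  assumes graph: "fin_simple_graph V E"
    and drawing: "plane_drawing V E p \<gamma>"
    and outer: "p ` V \<subseteq> frontier (outside (drawing_image V E p \<gamma>))"
begin

definition trace :: "'a set set \<Rightarrow> complex set" where
  "trace F = (\<Union>e\<in>F. path_image (\<gamma> e))"

lemma trace_Un: "trace (F \<union> F') = trace F \<union> trace F'"
  by (simp add: trace_def)

lemma edges: "e \<in> E \<Longrightarrow> e \<subseteq> V" "finite E"
proof -
  show "e \<in> E \<Longrightarrow> e \<subseteq> V" using graph by (simp add: fin_simple_graph_def)
  have "E \<subseteq> Pow V" using graph by (auto simp: fin_simple_graph_def)
  then show "finite E" using graph finite_subset by (auto simp: fin_simple_graph_def)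
qed

lemma arc_edge: "e \<in> E \<Longrightarrow> arc (\<gamma> e)"
  using drawing by (simp add: plane_drawing_def)

lemma inj_p: "inj_on p V"
  using drawing by (simp add: plane_drawing_def)

lemma trace_Int_vertices:
  assumes "F \<subseteq> E"
  shows "trace F \<inter> p ` V = p ` \<Union>F"
proof -
  have "path_image (\<gamma> e) \<inter> p ` V = p ` e" if "e \<in> F" for e
    using drawing subsetD[OF assms that] by (simp add: plane_drawing_def)
  then have "(\<Union>e\<in>F. path_image (\<gamma> e) \<inter> p ` V) = (\<Union>e\<in>F. p ` e)" by simp
  then show ?thesis by (simp add: trace_def image_Union)
qed

lemma trace_Int_trace:
  assumes "F \<subseteq> E" "F' \<subseteq> E" "F \<inter> F' = {}"
  shows "trace F \<inter> trace F' \<subseteq> p ` (\<Union>F \<inter> \<Union>F')"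
proof
  fix z assume "z \<in> trace F \<inter> trace F'"
  then obtain e f where ef: "e \<in> F" "f \<in> F'" "z \<in> path_image (\<gamma> e) \<inter> path_image (\<gamma> f)"
    by (auto simp: trace_def)
  then have "e \<in> E" "f \<in> E" "e \<noteq> f" using assms by auto
  then have "path_image (\<gamma> e) \<inter> path_image (\<gamma> f) \<subseteq> p ` (e \<inter> f)"
    using drawing unfolding plane_drawing_def by blast
  then have "z \<in> p ` (e \<inter> f)" using ef by blast
  then show "z \<in> p ` (\<Union>F \<inter> \<Union>F')" using ef by blast
qed

text \<open>Every neighbourhood of a vertex meets the outer face of the whole drawing, and this face
  lies in the outside of each part of the drawing; but \<open>inside (trace F)\<close> is
  open.\<close>

lemma vertex_not_inside:
  assumes "F \<subseteq> E" "v \<in> V"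
  shows "p v \<notin> inside (trace F)"
proof
  assume in_F: "p v \<in> inside (trace F)"
  have "finite F" using assms edges(2) finite_subset by blast
  then have "closed (trace F)"
    unfolding trace_def using assms arc_edge closed_arc_image by blast
  then have "open (inside (trace F))" by (rule open_inside)
  moreover have "p v \<in> closure (outside (drawing_image V E p \<gamma>))"
    using outer assms by (auto simp: frontier_def)
  ultimately have "inside (trace F) \<inter> outside (drawing_image V E p \<gamma>) \<noteq> {}"
    using in_F open_Int_closure_eq_empty by blast
  moreover have "outside (drawing_image V E p \<gamma>) \<subseteq> outside (trace F)"
    using assms by (intro outside_mono) (auto simp: trace_def drawing_image_def)
  ultimately show False using inside_Int_outside[of "trace F"] by blast
qed

text \<open>The arc \<open>\<gamma> {x, y}\<close> has no prescribed direction and is reversed if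
  necessary.\<close>

lemma edge_arc:
  assumes "{x, y} \<in> E"
  obtains g where "arc g" "pathstart g = p x" "pathfinish g = p y" "path_image g = path_image (\<gamma> {x, y})"
proof (cases "pathstart (\<gamma> {x, y}) = p x")
  case True
  have "{pathstart (\<gamma> {x, y}), pathfinish (\<gamma> {x, y})} = {p x, p y}"
    using drawing assms by (auto simp: plane_drawing_def)
  then show ?thesis using True arc_edge[OF assms] arc_distinct_ends[OF arc_edge[OF assms]]
    by (intro that[of "\<gamma> {x, y}"]) auto
next
  case False
  have "{pathstart (\<gamma> {x, y}), pathfinish (\<gamma> {x, y})} = {p x, p y}"
    using drawing assms by (auto simp: plane_drawing_def)
  then show ?thesis using False arc_edge[OF assms]
    by (intro that[of "reversepath (\<gamma> {x, y})"]) (auto simp: arc_reversepath doubleton_eq_iff)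
qed

text \<open>The edge arcs are joined one by one. Distinct edges meet only at common vertices, and
  the first edge shares only \<open>z\<close> with the rest of the path, so each join is again an
  arc.\<close>

lemma walk_arc:
  assumes "distinct (x # y # A)" "walk_edges x A y \<subseteq> E"
  shows "\<exists>g. arc g \<and> pathstart g = p x \<and> pathfinish g = p y \<and> path_image g = trace (walk_edges x A y)"
  using assms
proof (induction A arbitrary: x)
  case Nil
  then obtain g where "arc g" "pathstart g = p x" "pathfinish g = p y" "path_image g = path_image (\<gamma> {x, y})"
    using edge_arc[of x y] by (metis insert_subset walk_edges.simps(1))
  then show ?case by (intro exI[of _ g]) (simp add: trace_def)
next
  case (Cons z A)
  have "distinct (z # y # A)" "walk_edges z A y \<subseteq> E" using Cons.prems by auto
  then obtain h where h: "arc h" "pathstart h = p z" "pathfinish h = p y"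
    "path_image h = trace (walk_edges z A y)"
    using Cons.IH by blast
  have "trace {{x, z}} = path_image (\<gamma> {x, z})" by (simp add: trace_def)
  moreover have "{x, z} \<in> E" using Cons.prems by simp
  ultimately obtain g where g: "arc g" "pathstart g = p x" "pathfinish g = p z"
    "path_image g = trace {{x, z}}"
    using edge_arc[of x z] by metis
  have "{x, z} \<notin> walk_edges z A y"
    using Union_walk_edges[of z A y] Cons.prems(1) by auto
  then have "trace {{x, z}} \<inter> trace (walk_edges z A y) \<subseteq> p ` ({x, z} \<inter> ({z, y} \<union> set A))"
    using trace_Int_trace[of "{{x, z}}" "walk_edges z A y"] Cons.prems(2)
    by (simp add: Union_walk_edges)
  also have "\<dots> \<subseteq> {p z}" using Cons.prems(1) by auto
  finally have "path_image g \<inter> path_image h \<subseteq> {pathstart h}"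
    unfolding g(4) h(2,4) .
  then have "arc (g +++ h)"
    by (rule arc_join[OF g(1) h(1) trans[OF g(3) h(2)[symmetric]]])
  moreover have "path_image (g +++ h) = trace (walk_edges x (z # A) y)"
    unfolding path_image_join[OF trans[OF g(3) h(2)[symmetric]]] g(4) h(4) by (simp add: trace_def)
  ultimately show ?case using g(2) h(3) by (intro exI[of _ "g +++ h"] conjI) (simp_all only: pathstart_join pathfinish_join)
qed

text \<open>Inner vertices are demanded of \<open>P\<close> alone, so that \<open>Q = []\<close>
  covers the case of a chord.\<close>

lemma two_arcs_walks:
  assumes "distinct (a # b # P @ Q)" "P \<noteq> []" "walk_edges a P b \<subseteq> E" "walk_edges a Q b \<subseteq> E"
    and "arc g" "pathstart g = p a" "pathfinish g = p b" "path_image g = trace (walk_edges a P b)"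
    and "arc h" "pathstart h = p a" "pathfinish h = p b" "path_image h = trace (walk_edges a Q b)"
  shows "two_arcs g h (p a) (p b)"
proof
  have PQ: "set P \<inter> ({a, b} \<union> set Q) = {}" "({a, b} \<union> set P) \<inter> ({a, b} \<union> set Q) = {a, b}"
    using assms(1) by auto
  have "walk_edges a P b \<inter> walk_edges a Q b = {}"
    using walk_edges_meets[OF _ \<open>P \<noteq> []\<close>] PQ(1) Union_walk_edges[of a Q b] by blast
  then have "trace (walk_edges a P b) \<inter> trace (walk_edges a Q b) \<subseteq> p ` {a, b}"
    using trace_Int_trace[OF assms(3,4)] unfolding Union_walk_edges PQ(2) by simp
  then have "path_image g \<inter> path_image h \<subseteq> {p a, p b}" unfolding assms(8,12) by simp
  moreover have "{p a, p b} \<subseteq> path_image g" "{p a, p b} \<subseteq> path_image h"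
    using pathstart_in_path_image[of g] pathfinish_in_path_image[of g]
      pathstart_in_path_image[of h] pathfinish_in_path_image[of h] assms(6,7,10,11) by auto
  ultimately show "path_image g \<inter> path_image h = {p a, p b}" by blast
qed (use assms in auto)

text \<open>An inner vertex of the walk would lie inside \<open>trace F\<close>.\<close>

lemma walk_not_inside:
  assumes "distinct (a # b # P)" "P \<noteq> []" "walk_edges a P b \<subseteq> E" "F \<subseteq> E"
  shows "\<not> trace (walk_edges a P b) - {p a, p b} \<subseteq> inside (trace F)"
proof -
  obtain v where v: "v \<in> set P" using assms(2) by (cases P) auto
  have V: "{a, b} \<union> set P \<subseteq> V"
    unfolding Union_walk_edges[symmetric] using assms(3) edges(1) by blast
  then have "p v \<in> trace (walk_edges a P b)"
    using trace_Int_vertices[OF assms(3)] v by (auto simp: Union_walk_edges)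
  moreover have "p v \<noteq> p a" "p v \<noteq> p b"
    using inj_on_eq_iff[OF inj_p, of v] V v assms(1) by auto
  moreover have "p v \<notin> inside (trace F)"
    using V v by (intro vertex_not_inside assms) auto
  ultimately show ?thesis by blast
qed

text \<open>Whichever of the three arcs runs inside the cycle of the other two, it carries an inner
  vertex.\<close>

lemma theta_free: "theta_free E"
  unfolding theta_free_def
proof (intro allI impI notI)
  fix a b P Q R
  assume d: "distinct (a # b # P @ Q @ R)" and ne: "P \<noteq> []" "Q \<noteq> []" "R \<noteq> []"
    and E: "walk_edges a P b \<union> walk_edges a Q b \<union> walk_edges a R b \<subseteq> E"
  obtain g where g: "arc g" "pathstart g = p a" "pathfinish g = p b" "path_image g = trace (walk_edges a P b)"
    using walk_arc[of a b P] d E by auto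
  obtain h where h: "arc h" "pathstart h = p a" "pathfinish h = p b" "path_image h = trace (walk_edges a Q b)"
    using walk_arc[of a b Q] d E by auto
  obtain k where k: "arc k" "pathstart k = p a" "pathfinish k = p b" "path_image k = trace (walk_edges a R b)"
    using walk_arc[of a b R] d E by auto
  have d': "distinct (a # b # P @ Q)" "distinct (a # b # P @ R)" "distinct (a # b # Q @ R)"
    using d by auto
  have E': "walk_edges a P b \<subseteq> E" "walk_edges a Q b \<subseteq> E" "walk_edges a R b \<subseteq> E"
    using E by auto
  from two_arcs_walks[OF d'(1) ne(1) E'(1,2) g h] two_arcs_walks[OF d'(2) ne(1) E'(1,3) g k]
    two_arcs_walks[OF d'(3) ne(2) E'(2,3) h k]
  show False
  proof (cases rule: theta_inside)
    case 1
    then show ?thesis using walk_not_inside[of a b P "walk_edges a Q b \<union> walk_edges a R b"] d' ne E'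
      by (simp add: trace_Un g h k)
  next
    case 2
    then show ?thesis using walk_not_inside[of a b Q "walk_edges a P b \<union> walk_edges a R b"] d' ne E'
      by (simp add: trace_Un g h k)
  next
    case 3
    then show ?thesis using walk_not_inside[of a b R "walk_edges a P b \<union> walk_edges a Q b"] d' ne E'
      by (simp add: trace_Un g h k)
  qed
qed

text \<open>Of the three arcs only the chord has no inner vertex, so it must be the one that runs
  inside the cycle of the others.\<close>

lemma chord_inside:
  assumes d: "distinct (a # b # P @ Q)" and ne: "P \<noteq> []" "Q \<noteq> []"
    and E: "walk_edges a P b \<subseteq> E" "walk_edges a Q b \<subseteq> E" "{a, b} \<in> E"
  obtains g h k where "two_arcs g h (p a) (p b)" "two_arcs g k (p a) (p b)" "two_arcs h k (p a) (p b)"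
    "path_image g = trace (walk_edges a P b)" "path_image h = trace (walk_edges a Q b)"
    "path_image k = trace {{a, b}}"
    "path_image k - {p a, p b} \<subseteq> inside (trace (walk_edges a P b \<union> walk_edges a Q b))"
proof -
  obtain g where g: "arc g" "pathstart g = p a" "pathfinish g = p b" "path_image g = trace (walk_edges a P b)"
    using walk_arc[of a b P] d E by auto
  obtain h where h: "arc h" "pathstart h = p a" "pathfinish h = p b" "path_image h = trace (walk_edges a Q b)"
    using walk_arc[of a b Q] d E by auto
  obtain k where k: "arc k" "pathstart k = p a" "pathfinish k = p b" "path_image k = trace (walk_edges a [] b)"
    using walk_arc[of a b "[]"] d E by auto
  have d': "distinct (a # b # P @ [])" "distinct (a # b # Q @ [])" "distinct (a # b # P)" "distinct (a # b # Q)"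
    using d by auto
  have E': "walk_edges a [] b \<subseteq> E" using E by simp
  note * = two_arcs_walks[OF d ne(1) E(1,2) g h] two_arcs_walks[OF d'(1) ne(1) E(1) E' g k]
    two_arcs_walks[OF d'(2) ne(2) E(2) E' h k]
  then show ?thesis
  proof (cases rule: theta_inside)
    case 1
    then show ?thesis using walk_not_inside[OF d'(3) ne(1) E(1), of "walk_edges a Q b \<union> walk_edges a [] b"] E E'
      by (simp add: trace_Un g h k del: walk_edges.simps)
  next
    case 2
    then show ?thesis using walk_not_inside[OF d'(4) ne(2) E(2), of "walk_edges a P b \<union> walk_edges a [] b"] E E'
      by (simp add: trace_Un g h k del: walk_edges.simps)
  next
    case 3
    then show ?thesis using that[OF * g(4) h(4)] k(4) by (simp add: trace_Un g h)
  qed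
qed

text \<open>Both chords run inside the cycle and are disjoint, so \<open>b\<close> or
  \<open>d\<close> would lie inside a cycle formed by the chord \<open>{a, c}\<close> and one part
  of the big cycle.\<close>

lemma crossing_free: "crossing_free E"
  unfolding crossing_free_def
proof (intro allI impI notI)
  fix a b c d A B C D
  assume dist: "distinct (a # b # c # d # A @ B @ C @ D)"
    and E: "walk_edges a A b \<union> walk_edges b B c \<union> walk_edges c C d \<union> walk_edges d D a \<subseteq> E"
    and chords: "{{a, c}, {b, d}} \<subseteq> E"
  \<comment> \<open>The cycle is cut at \<open>a\<close>, \<open>c\<close> and again at
    \<open>b\<close>, \<open>d\<close>; each time one part is reversed, so that both parts run
    between the same ends in the same direction.\<close>
  have w: "walk_edges a (A @ b # B) c = walk_edges a A b \<union> walk_edges b B c"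
    "walk_edges a (rev (C @ d # D)) c = walk_edges c C d \<union> walk_edges d D a"
    "walk_edges b (B @ c # C) d = walk_edges b B c \<union> walk_edges c C d"
    "walk_edges b (rev (D @ a # A)) d = walk_edges d D a \<union> walk_edges a A b"
    by (simp_all only: walk_edges_rev walk_edges_append)
  have d: "distinct (a # c # (A @ b # B) @ rev (C @ d # D))" "distinct (b # d # (B @ c # C) @ rev (D @ a # A))"
    using dist by auto
  have E': "walk_edges a (A @ b # B) c \<subseteq> E" "walk_edges a (rev (C @ d # D)) c \<subseteq> E"
    "walk_edges b (B @ c # C) d \<subseteq> E" "walk_edges b (rev (D @ a # A)) d \<subseteq> E" "{a, c} \<in> E" "{b, d} \<in> E"
    using E chords unfolding w by auto
  obtain g h k where ghk: "two_arcs g h (p a) (p c)" "two_arcs g k (p a) (p c)" "two_arcs h k (p a) (p c)"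
    "path_image g = trace (walk_edges a A b \<union> walk_edges b B c)"
    "path_image h = trace (walk_edges c C d \<union> walk_edges d D a)"
    "path_image k = trace {{a, c}}"
    "path_image k - {p a, p c} \<subseteq> inside (trace ((walk_edges a A b \<union> walk_edges b B c) \<union> (walk_edges c C d \<union> walk_edges d D a)))"
    by (rule chord_inside[OF d(1) _ _ E'(1,2,5), unfolded w]) simp_all
  obtain g' h' q where q: "two_arcs g' q (p b) (p d)"
    "path_image q = trace {{b, d}}"
    "path_image q - {p b, p d} \<subseteq> inside (trace ((walk_edges b B c \<union> walk_edges c C d) \<union> (walk_edges d D a \<union> walk_edges a A b)))"
    by (rule chord_inside[OF d(2) _ _ E'(3,4,6), unfolded w]) simp_all
  \<comment> \<open>Both ways of cutting describe the same cycle.\<close>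
  have K: "path_image g \<union> path_image h = trace ((walk_edges a A b \<union> walk_edges b B c) \<union> (walk_edges c C d \<union> walk_edges d D a))"
    "path_image g \<union> path_image h = trace ((walk_edges b B c \<union> walk_edges c C d) \<union> (walk_edges d D a \<union> walk_edges a A b))"
    using ghk(4,5) by (simp_all add: trace_Un Un_ac)
  have V: "b \<in> V" "d \<in> V" using edges(1)[OF E'(6)] by auto
  have sub: "walk_edges a A b \<union> walk_edges b B c \<union> {{a, c}} \<subseteq> E"
    "walk_edges c C d \<union> walk_edges d D a \<union> {{a, c}} \<subseteq> E" using E chords by auto
  have "path_image q \<inter> path_image k = {}"
    using trace_Int_trace[of "{{b, d}}" "{{a, c}}"] dist chords q ghk by (auto simp: doubleton_eq_iff)
  moreover have "p b \<in> path_image g" "p d \<in> path_image h"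
    using trace_Int_vertices[of "walk_edges a A b \<union> walk_edges b B c"]
      trace_Int_vertices[of "walk_edges c C d \<union> walk_edges d D a"] E ghk
    by (auto simp: Union_walk_edges)
  ultimately consider "p d \<in> inside (path_image g \<union> path_image k)" | "p b \<in> inside (path_image h \<union> path_image k)"
    using crossing_arcs_inside[OF ghk(1-3) ghk(7)[folded K] _ _ _ q(3)[folded K(2)]] two_arcs.arcs(2)[OF q(1)] two_arcs.ends(3,4)[OF q(1)]
    by blast
  then show False
  proof cases
    case 1
    then show ?thesis
      using vertex_not_inside[OF sub(1) V(2)] unfolding ghk(4-6) trace_Un[symmetric] by contradiction
  next
    case 2
    then show ?thesis
      using vertex_not_inside[OF sub(2) V(1)] unfolding ghk(4-6) trace_Un[symmetric] by contradiction
  qed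
qed

end

section \<open>Noncrossing linear orders\<close>

definition noncrossing :: "('a \<Rightarrow> nat) \<Rightarrow> 'a set set \<Rightarrow> bool" where
  "noncrossing f E \<longleftrightarrow>
     (\<forall>a b c d. {a, c} \<in> E \<longrightarrow> {b, d} \<in> E \<longrightarrow> f a < f b \<longrightarrow> f b < f c \<longrightarrow> \<not> f c < f d)"

lemma noncrossingD:
  "noncrossing f E \<Longrightarrow> {a, c} \<in> E \<Longrightarrow> {b, d} \<in> E \<Longrightarrow> \<not> (f a < f b \<and> f b < f c \<and> f c < f d)"
  by (simp add: noncrossing_def)

lemma noncrossing_mono: "noncrossing f E \<Longrightarrow> E' \<subseteq> E \<Longrightarrow> noncrossing f E'"
  unfolding noncrossing_def by (meson subsetD)

text \<open>A one-page book embedding: the vertices stand on the spine in the order given by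
  \<open>f\<close>, the edges are drawn in a single half-plane.\<close>

definition one_page :: "'a set \<Rightarrow> 'a set set \<Rightarrow> bool" where
  "one_page V E \<longleftrightarrow> (\<exists>f :: 'a \<Rightarrow> nat. inj_on f V \<and> noncrossing f E)"

text \<open>Whether two edges cross depends only on the cyclic order of their ends, so the positions
  before \<open>v\<close> can be moved behind all others.\<close>

lemma one_page_rotate:
  assumes "one_page V E" "finite V" "\<And>e. e \<in> E \<Longrightarrow> e \<subseteq> V" "v \<in> V"
  obtains g :: "'a \<Rightarrow> nat" where "inj_on g V" "noncrossing g E" "\<forall>u\<in>V. g v \<le> g u"
proof -
  obtain f :: "'a \<Rightarrow> nat" where f: "inj_on f V" and nc: "noncrossing f E"
    using assms(1) by (auto simp: one_page_def)
  obtain M where "\<forall>m \<in> f ` V. m < M"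
    using assms(2) by (metis finite_imageI finite_nat_set_iff_bounded)
  then have M: "f u < M" if "u \<in> V" for u using that by auto
  define g where "g u = (if f u < f v then f u + M else f u)" for u
  have "inj_on g V"
  proof (rule inj_onI)
    fix x y assume "x \<in> V" "y \<in> V" "g x = g y"
    then have "f x = f y" using M[of x] M[of y] by (auto simp: g_def split: if_splits)
    then show "x = y" using f \<open>x \<in> V\<close> \<open>y \<in> V\<close> by (auto dest: inj_onD)
  qed
  moreover have "noncrossing g E"
    unfolding noncrossing_def
  proof (intro allI impI notI)
    fix a b c d
    assume E: "{a, c} \<in> E" "{b, d} \<in> E" and less: "g a < g b" "g b < g c" "g c < g d"
    have V: "a \<in> V" "b \<in> V" "c \<in> V" "d \<in> V" using E assms(3) by auto
    have E': "{c, a} \<in> E" "{d, b} \<in> E" using E by (simp_all add: insert_commute)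
    \<comment> \<open>Ends in increasing order for \<open>g\<close> are in increasing order for
      \<open>f\<close> up to a cyclic shift; all four shifts are excluded here.\<close>
    have "\<not> (f a < f b \<and> f b < f c \<and> f c < f d)" "\<not> (f d < f a \<and> f a < f b \<and> f b < f c)"
      "\<not> (f c < f d \<and> f d < f a \<and> f a < f b)" "\<not> (f b < f c \<and> f c < f d \<and> f d < f a)"
      by (rule noncrossingD[OF nc E] noncrossingD[OF nc E'(2) E(1)] noncrossingD[OF nc E']
          noncrossingD[OF nc E(2) E'(1)])+
    moreover have wrap: "f y < f v \<and> (f v \<le> f x \<or> f x < f y) \<or> f v \<le> f x \<and> f x < f y"
      if "g x < g y" "x \<in> V" "y \<in> V" for x y
      using that(1) M[OF that(2)] M[OF that(3)] unfolding g_def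
      by (cases "f x < f v"; cases "f y < f v") auto
    ultimately show False
      using wrap[OF less(1) V(1,2)] wrap[OF less(2) V(2,3)] wrap[OF less(3) V(3,4)] by linarith
  qed
  moreover have "g v \<le> g u" if "u \<in> V" for u
    using M[OF \<open>v \<in> V\<close>] by (simp add: g_def)
  ultimately show ?thesis using that by blast
qed

text \<open>Both orders are rotated to start at \<open>v\<close>, and \<open>B\<close> is put behind
  \<open>A\<close>. An edge from \<open>v\<close> into \<open>B\<close> then passes over all of
  \<open>A\<close> and crosses nothing there.\<close>

lemma one_page_glue:
  assumes fin: "finite A" "finite B" and AB: "A \<inter> B = {}" "v \<notin> A" "v \<notin> B"
    and A: "one_page (insert v A) {e \<in> E. e \<subseteq> insert v A}"
    and B: "one_page (insert v B) {e \<in> E. e \<subseteq> insert v B}"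
    and E: "\<And>e. e \<in> E \<Longrightarrow> e \<subseteq> insert v A \<or> e \<subseteq> insert v B"
  shows "one_page (insert v (A \<union> B)) E"
proof -
  obtain f :: "'a \<Rightarrow> nat" where f: "inj_on f (insert v A)" "noncrossing f {e \<in> E. e \<subseteq> insert v A}"
    "\<forall>u\<in>insert v A. f v \<le> f u"
    using one_page_rotate[OF A, of v] fin by auto
  obtain g :: "'a \<Rightarrow> nat" where g: "inj_on g (insert v B)" "noncrossing g {e \<in> E. e \<subseteq> insert v B}"
    "\<forall>u\<in>insert v B. g v \<le> g u"
    using one_page_rotate[OF B, of v] fin by auto
  obtain M where "\<forall>m \<in> f ` insert v A. m < M"
    using fin by (metis finite_imageI finite_insert finite_nat_set_iff_bounded)
  then have M: "f u < M" if "u \<in> insert v A" for u using that by auto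
  \<comment> \<open>\<open>M\<close> exceeds all positions in \<open>insert v A\<close>; the common
    vertex \<open>v\<close> keeps its position from \<open>f\<close>.\<close>
  define h where "h u = (if u \<in> B then g u + M else f u)" for u
  have hA: "h u = f u" if "u \<in> insert v A" for u using that AB by (auto simp: h_def)
  have hB: "h u = g u + M" if "u \<in> B" for u using that by (simp add: h_def)
  have fv: "f v < f u" if "u \<in> A" for u
    using f(1,3) that AB by (metis inj_onD insertCI le_neq_implies_less)
  have gv: "g v < g u" if "u \<in> B" for u
    using g(1,3) that AB by (metis inj_onD insertCI le_neq_implies_less)
  have lessM: "h u < M" if "u \<in> insert v (A \<union> B)" "u \<notin> B" for u
    using that hA[of u] M[of u] by auto
  have lessB: "y \<in> B" if "h x < h y" "x \<in> B" "y \<in> insert v (A \<union> B)" for x y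
    using that lessM[of y] hB[of x] by (cases "y \<in> B") auto
  have notv: "y \<noteq> v" if "h x < h y" "x \<in> insert v (A \<union> B)" for x y
  proof
    assume "y = v"
    then show False
      using that lessM[of v] hA[of x] hB[of x] hA[of v] f(3) AB by (cases "x \<in> B") auto
  qed
  have "inj_on h (insert v (A \<union> B))"
  proof (rule inj_onI)
    fix x y assume xy: "x \<in> insert v (A \<union> B)" "y \<in> insert v (A \<union> B)" and eq: "h x = h y"
    then have "x \<in> B \<longleftrightarrow> y \<in> B" using lessM[of x] lessM[of y] hB[of x] hB[of y] by (metis not_add_less2)
    then show "x = y"
      using xy eq hA hB inj_onD[OF f(1), of x y] inj_onD[OF g(1), of x y]
      by (cases "x \<in> B") auto
  qed
  moreover have "noncrossing h E"
    unfolding noncrossing_def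
  proof (intro allI impI notI)
    fix a b c d
    assume ac: "{a, c} \<in> E" and bd: "{b, d} \<in> E" and less: "h a < h b" "h b < h c" "h c < h d"
    have V: "a \<in> insert v (A \<union> B)" "b \<in> insert v (A \<union> B)" "c \<in> insert v (A \<union> B)" "d \<in> insert v (A \<union> B)"
      using E[OF ac] E[OF bd] by auto
    have nv: "b \<noteq> v" "c \<noteq> v" "d \<noteq> v" using notv less V by blast+
    \<comment> \<open>If \<open>c\<close> is in \<open>B\<close>, so is \<open>d\<close>; otherwise
      \<open>c\<close> and \<open>b\<close> are in \<open>A\<close>. As \<open>b\<close>,
      \<open>c\<close>, \<open>d\<close> differ from \<open>v\<close>, both edges lie on the same
      side in either case.\<close>
    show False
    proof (cases "c \<in> B")
      case True
      then have "{a, c} \<subseteq> insert v B" "d \<in> B" using E[OF ac] AB nv lessB less V by auto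
      moreover from this have "{b, d} \<subseteq> insert v B" using E[OF bd] AB nv by auto
      moreover have "b \<in> B" using calculation nv by auto
      moreover have "g a < g b"
        using less(1) hB[OF \<open>b \<in> B\<close>] hB[of a] gv[OF \<open>b \<in> B\<close>] calculation by auto
      moreover have "g b < g c" "g c < g d"
        using less hB[OF \<open>b \<in> B\<close>] hB[OF True] hB[OF \<open>d \<in> B\<close>] by auto
      ultimately show False using noncrossingD[OF g(2), of a c b d] ac bd by simp
    next
      case False
      then have "c \<in> A" "b \<in> A" using nv V less lessB by auto
      then have "{a, c} \<subseteq> insert v A" "{b, d} \<subseteq> insert v A"
        using E[OF ac] E[OF bd] AB nv by auto
      moreover have "f a < f b" "f b < f c" "f c < f d" using calculation less hA by auto
      ultimately show False using noncrossingD[OF f(2), of a c b d] ac bd by simp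
    qed
  qed
  ultimately show ?thesis unfolding one_page_def by blast
qed

section \<open>Cut vertices, ears and Hamiltonian cycles\<close>

lemma theta_free_mono: "theta_free E \<Longrightarrow> E' \<subseteq> E \<Longrightarrow> theta_free E'"
  unfolding theta_free_def by (meson order_trans)

lemma crossing_free_mono: "crossing_free E \<Longrightarrow> E' \<subseteq> E \<Longrightarrow> crossing_free E'"
  unfolding crossing_free_def by (meson order_trans)

text \<open>The list \<open>A\<close> may have length 1: an edge counts as a cycle, which starts the search for a
  longest one.\<close>
definition cycle :: "'a set set \<Rightarrow> 'a \<Rightarrow> 'a list \<Rightarrow> bool" where
  "cycle E x A \<longleftrightarrow> distinct (x # A) \<and> A \<noteq> [] \<and> walk_edges x A x \<subseteq> E"

lemma cycle_rotate1: "cycle E x (A @ y # B) \<Longrightarrow> cycle E y (B @ x # A)"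
  by (auto simp: cycle_def walk_edges_append)

lemma cycle_rotate:
  assumes "cycle E x A" "y \<in> set (x # A)"
  obtains B where "cycle E y B" "set (y # B) = set (x # A)" "length B = length A"
proof (cases "y = x")
  case False
  then obtain A1 A2 where A: "A = A1 @ y # A2" using assms(2) by (auto dest: split_list)
  then show ?thesis using assms(1) cycle_rotate1 by (intro that[of "A2 @ x # A1"]) auto
qed (use assms that in blast)

text \<open>If \<open>y\<close> is already on the path, the path is cut there; otherwise it is
  prolonged by the edge.\<close>

lemma walk_truncate:
  assumes "distinct (x # P @ [z])" "walk_edges x P z \<subseteq> E" "{z, y} \<in> E" "y \<notin> {x, z}"
  obtains Q where "distinct (x # Q @ [y])" "walk_edges x Q y \<subseteq> E" "set Q \<subseteq> insert z (set P)"
proof (cases "y \<in> set P")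
  case True
  then obtain P1 P2 where P: "P = P1 @ y # P2" by (auto dest: split_list)
  then show ?thesis using assms by (intro that[of P1]) (auto simp: walk_edges_append)
next
  case False
  then show ?thesis using assms by (intro that[of "P @ [z]"]) (auto simp: walk_edges_append)
qed

text \<open>\<open>v\<close> is a cut vertex; disconnected graphs with at least three vertices count
  as well, so gluing at \<open>v\<close> treats both kinds.\<close>

definition separable :: "'a set \<Rightarrow> 'a set set \<Rightarrow> bool" where
  "separable V E \<longleftrightarrow> (\<exists>v A B. V = insert v (A \<union> B) \<and> A \<noteq> {} \<and> B \<noteq> {} \<and> A \<inter> B = {} \<and>
     v \<notin> A \<and> v \<notin> B \<and> (\<forall>a\<in>A. \<forall>b\<in>B. {a, b} \<notin> E))"

text \<open>Non-separability is used twice: at \<open>x\<close>, to find an edge leaving the cycle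
  at some \<open>y\<close>, and at \<open>y\<close>, to return to the cycle at another vertex
  \<open>z\<close>.\<close>

lemma ear_exists:
  assumes V: "\<And>e. e \<in> E \<Longrightarrow> e \<subseteq> V" and ns: "\<not> separable V E"
    and cyc: "cycle E x A" and sub: "set (x # A) \<subset> V"
  obtains y B z P where "cycle E y B" "length B = length A" "set (y # B) = set (x # A)"
    "z \<in> set B" "P \<noteq> []" "distinct (y # P @ [z])" "set P \<inter> set (y # B) = {}" "walk_edges y P z \<subseteq> E"
proof -
  have "A \<noteq> []" "x \<notin> set A" using cyc by (auto simp: cycle_def)
  let ?C = "set (x # A)"
  have "\<exists>a\<in>V - ?C. \<exists>b\<in>set A. {a, b} \<in> E"
  proof (rule ccontr)
    assume "\<not> ?thesis"
    moreover have "V = insert x ((V - ?C) \<union> set A)" using sub by auto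
    ultimately have "separable V E"
      unfolding separable_def using sub \<open>A \<noteq> []\<close> \<open>x \<notin> set A\<close>
      by (intro exI[of _ x] exI[of _ "V - ?C"] exI[of _ "set A"]) auto
    then show False using ns by simp
  qed
  then obtain v y where v: "v \<in> V - ?C" and y: "y \<in> ?C" and vy: "{y, v} \<in> E"
    by (auto simp: insert_commute)
  obtain B where B: "cycle E y B" "set (y # B) = ?C" "length B = length A"
    using cycle_rotate[OF cyc y] .
  have "B \<noteq> []" "y \<notin> set B" using B by (auto simp: cycle_def)
  \<comment> \<open>These are the vertices reachable from \<open>y\<close> off the cycle. If edges
    left \<open>S\<close> only towards \<open>y\<close>, then \<open>y\<close> would separate
    \<open>S\<close> from the rest of the cycle.\<close>
  define S where "S = {z \<in> V - ?C. \<exists>P. distinct (y # P @ [z]) \<and> set P \<subseteq> V - ?C \<and> walk_edges y P z \<subseteq> E}"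
  have "v \<in> S" using v y vy unfolding S_def by (auto intro!: exI[of _ "[]"])
  have "S \<subseteq> V" "S \<inter> ?C = {}" by (auto simp: S_def)
  have "\<exists>a\<in>S. \<exists>b\<in>V - {y} - S. {a, b} \<in> E"
  proof (rule ccontr)
    assume "\<not> ?thesis"
    moreover have "V = insert y (S \<union> (V - {y} - S))" using \<open>S \<subseteq> V\<close> y sub by blast
    moreover have "set B \<subseteq> V - {y} - S"
      using \<open>S \<inter> ?C = {}\<close> \<open>y \<notin> set B\<close> B(2) sub by auto
    then have "V - {y} - S \<noteq> {}" using \<open>B \<noteq> []\<close> by (metis set_empty subset_empty)
    moreover have "y \<notin> S" using y \<open>S \<inter> ?C = {}\<close> by blast
    ultimately show False
      using ns \<open>v \<in> S\<close> unfolding separable_def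
      by (metis (no_types, lifting) Diff_disjoint Diff_iff empty_iff singletonI)
  qed
  then obtain a z where a: "a \<in> S" and z: "z \<in> V" "z \<noteq> y" "z \<notin> S" and az: "{a, z} \<in> E" by blast
  obtain P where P: "distinct (y # P @ [a])" "set P \<subseteq> V - ?C" "walk_edges y P a \<subseteq> E"
    and aV: "a \<in> V - ?C" using a by (auto simp: S_def)
  have "z \<noteq> a" using a z by auto
  then obtain Q where Q: "distinct (y # Q @ [z])" "walk_edges y Q z \<subseteq> E" "set Q \<subseteq> insert a (set P)"
    using walk_truncate[OF P(1,3) az] z by blast
  \<comment> \<open>If \<open>z\<close> were off the cycle, \<open>Q\<close> would put it into
    \<open>S\<close>.\<close>
  have "set Q \<subseteq> V - ?C" using Q(3) P(2) aV by blast
  then have "z \<in> ?C" using Q(1,2) z by (auto simp: S_def)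
  then have "z \<in> set B" using B(2) z by auto
  have "a \<notin> ?C" using aV by blast
  have "distinct (y # (P @ [a]) @ [z])"
    using P(1,2) \<open>z \<in> ?C\<close> z(2) \<open>z \<noteq> a\<close> by auto
  moreover have "walk_edges y (P @ [a]) z \<subseteq> E" using P(3) az by (simp add: walk_edges_append)
  moreover have "set (P @ [a]) \<inter> set (y # B) = {}" unfolding B(2) using P(2) aV by auto
  ultimately show ?thesis using that[OF B(1,3,2) \<open>z \<in> set B\<close>, of "P @ [a]"] by blast
qed

text \<open>The ends of an ear cut a longest cycle into two parts. Neither part has an empty
  interior, since replacing it by the ear would give a longer cycle; so the ear and the two parts
  form a forbidden theta.\<close>

lemma hamiltonian_cycle:
  assumes fin: "finite V" and V: "\<And>e. e \<in> E \<Longrightarrow> e \<subseteq> V \<and> card e = 2" and "E \<noteq> {}"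
    and ns: "\<not> separable V E" and tf: "theta_free E"
  obtains x A where "cycle E x A" "set (x # A) = V"
proof -
  have sub: "set (x # A) \<subseteq> V" if "cycle E x A" for x A
    using that Union_walk_edges[of x A x] V unfolding cycle_def by fastforce
  have bound: "length A \<le> card V" if "cycle E x A" for x A
  proof -
    have "card (set A) \<le> card V" using sub[OF that] by (intro card_mono fin) auto
    then show ?thesis using that by (simp add: cycle_def distinct_card)
  qed
  obtain e where "e \<in> E" using \<open>E \<noteq> {}\<close> by blast
  then obtain x y where "{x, y} \<in> E" "x \<noteq> y" using V by (metis card_2_iff)
  then have "cycle E x [y]" by (simp add: cycle_def insert_commute)
  then have "\<exists>x A. cycle E x A \<and> length A = 1" by (intro exI[of _ x] exI[of _ "[y]"]) simp
  moreover have "\<forall>n. (\<exists>x A. cycle E x A \<and> length A = n) \<longrightarrow> n \<le> card V" using bound by blast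
  ultimately obtain n where "\<exists>x A. cycle E x A \<and> length A = n"
    and "\<forall>m. (\<exists>x A. cycle E x A \<and> length A = m) \<longrightarrow> m \<le> n"
    using Nat.ex_has_greatest_nat[of "\<lambda>n. \<exists>x A. cycle E x A \<and> length A = n" 1 "card V"] by blast
  then obtain x A where cyc: "cycle E x A" and max: "\<And>y B. cycle E y B \<Longrightarrow> length B \<le> length A"
    by metis
  have "set (x # A) = V"
  proof (rule ccontr)
    assume "set (x # A) \<noteq> V"
    then have psub: "set (x # A) \<subset> V" using sub[OF cyc] by blast
    have EV: "\<And>e. e \<in> E \<Longrightarrow> e \<subseteq> V" using V by blast
    obtain y B z P where B: "cycle E y B" "length B = length A" and z: "z \<in> set B"
      and P: "P \<noteq> []" "distinct (y # P @ [z])" "set P \<inter> set (y # B) = {}" "walk_edges y P z \<subseteq> E"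
      using ear_exists[OF EV ns cyc psub] by metis
    obtain B1 B2 where B12: "B = B1 @ z # B2" using z by (auto dest: split_list)
    have w: "walk_edges y B1 z \<subseteq> E" "walk_edges z B2 y \<subseteq> E" and d: "distinct (y # B1 @ z # B2)"
      using B(1) unfolding cycle_def B12 walk_edges_append by auto
    have "cycle E y (P @ z # B2)"
      using w P d unfolding cycle_def walk_edges_append B12 by auto
    then have "B1 \<noteq> []" using max[of y "P @ z # B2"] B(2) P(1) unfolding B12 by (cases P) auto
    have "cycle E y (B1 @ z # rev P)"
      using w P d unfolding cycle_def walk_edges_append B12 walk_edges_rev by auto
    then have "B2 \<noteq> []" using max[of y "B1 @ z # rev P"] B(2) P(1) unfolding B12 by (cases P) auto
    have "distinct (y # z # P @ B1 @ rev B2)" using d P unfolding B12 by auto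
    moreover have "walk_edges y P z \<union> walk_edges y B1 z \<union> walk_edges y (rev B2) z \<subseteq> E"
      using w P by (simp add: walk_edges_rev)
    ultimately show False
      using tf \<open>P \<noteq> []\<close> \<open>B1 \<noteq> []\<close> \<open>B2 \<noteq> []\<close> unfolding theta_free_def by (metis rev_is_Nil_conv)
  qed
  then show ?thesis using that cyc by blast
qed

lemma drop_split: "i \<le> j \<Longrightarrow> j < length xs \<Longrightarrow> \<exists>A. drop i xs = A @ xs ! j # drop (Suc j) xs"
  using id_take_nth_drop[of "j - i" "drop i xs"] by (intro exI[of _ "take (j - i) (drop i xs)"]) simp

text \<open>The vertices are placed in their order along the cycle; two edges that cross would be
  crossing chords of it.\<close>

lemma one_page_cycle:
  assumes cyc: "cycle E x A" and V: "set (x # A) = V" "\<And>e. e \<in> E \<Longrightarrow> e \<subseteq> V" and cf: "crossing_free E"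
  shows "one_page V E"
proof -
  let ?xs = "x # A"
  have "\<forall>u\<in>V. \<exists>i<length ?xs. ?xs ! i = u" using V(1) by (metis in_set_conv_nth)
  then obtain f where f: "\<And>u. u \<in> V \<Longrightarrow> f u < length ?xs \<and> ?xs ! (f u) = u" by metis
  have "inj_on f V" using f by (metis inj_onI)
  moreover have "noncrossing f E"
    unfolding noncrossing_def
  proof (intro allI impI notI)
    fix a b c d
    assume E: "{a, c} \<in> E" "{b, d} \<in> E" and less: "f a < f b" "f b < f c" "f c < f d"
    have abcd: "a \<in> V" "b \<in> V" "c \<in> V" "d \<in> V" using E V(2) by blast+
    obtain S A' B C D where xs: "?xs = S @ a # A' @ b # B @ c # C @ d # D"
      using drop_split[of 0 "f a" ?xs] drop_split[of "Suc (f a)" "f b" ?xs]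
        drop_split[of "Suc (f b)" "f c" ?xs] drop_split[of "Suc (f c)" "f d" ?xs]
        f[OF abcd(1)] f[OF abcd(2)] f[OF abcd(3)] f[OF abcd(4)] less
      by (metis Suc_leI drop0 le0)
    \<comment> \<open>The prefix \<open>S\<close> is moved into the last segment, so that the cycle
      starts at \<open>a\<close>.\<close>
    have "\<exists>D. cycle E a (A' @ b # B @ c # C @ d # D)"
    proof (cases S)
      case Nil
      then show ?thesis using xs cyc by auto
    next
      case (Cons y S')
      then have "cycle E x (S' @ a # A' @ b # B @ c # C @ d # D)" using xs cyc by simp
      then show ?thesis using cycle_rotate1 by fastforce
    qed
    then obtain D' where D': "cycle E a (A' @ b # B @ c # C @ d # D')" ..
    then have "distinct (a # b # c # d # A' @ B @ C @ D')" by (auto simp: cycle_def)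
    moreover have "walk_edges a A' b \<union> walk_edges b B c \<union> walk_edges c C d \<union> walk_edges d D' a \<subseteq> E"
      using D' by (auto simp: cycle_def walk_edges_append)
    ultimately have "\<not> {{a, c}, {b, d}} \<subseteq> E"
      by (rule cf[unfolded crossing_free_def, rule_format])
    then show False using E by simp
  qed
  ultimately show ?thesis unfolding one_page_def by blast
qed

text \<open>Both exclusions pass to the two sides of a cut vertex, where induction applies. A graph
  that is not separable has no edges or a spanning \<open>cycle\<close>.\<close>

lemma one_page_if_free:
  assumes "finite V" "\<And>e. e \<in> E \<Longrightarrow> e \<subseteq> V \<and> card e = 2" "theta_free E" "crossing_free E"
  shows "one_page V E"
  using assms
proof (induction "card V" arbitrary: V E rule: less_induct)
  case less
  show ?case
  proof (cases "separable V E")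
    case True
    then obtain v A B where V: "V = insert v (A \<union> B)" and ne: "A \<noteq> {}" "B \<noteq> {}"
      and disj: "A \<inter> B = {}" "v \<notin> A" "v \<notin> B" and sep: "\<And>a b. a \<in> A \<Longrightarrow> b \<in> B \<Longrightarrow> {a, b} \<notin> E"
      unfolding separable_def by blast
    have fin: "finite A" "finite B" using less.prems(1) V by auto
    obtain a b where "a \<in> A" "b \<in> B" using ne by blast
    then have "a \<in> V - insert v B" "b \<in> V - insert v A" using V disj by auto
    moreover have "insert v A \<subseteq> V" "insert v B \<subseteq> V" using V by auto
    ultimately have "insert v A \<subset> V" "insert v B \<subset> V" by blast+
    then have card: "card (insert v A) < card V" "card (insert v B) < card V"
      by (simp_all only: psubset_card_mono[OF less.prems(1)])
    have mono: "theta_free {e \<in> E. e \<subseteq> W}" "crossing_free {e \<in> E. e \<subseteq> W}" for W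
      using theta_free_mono[OF less.prems(3)] crossing_free_mono[OF less.prems(4)] by simp_all
    have "one_page (insert v A) {e \<in> E. e \<subseteq> insert v A}"
      using fin less.prems(2) by (intro less.hyps[OF card(1)] mono) auto
    moreover have "one_page (insert v B) {e \<in> E. e \<subseteq> insert v B}"
      using fin less.prems(2) by (intro less.hyps[OF card(2)] mono) auto
    moreover have "e \<subseteq> insert v A \<or> e \<subseteq> insert v B" if e: "e \<in> E" for e
    proof -
      obtain x y where "e = {x, y}" using less.prems(2)[OF e] by (metis card_2_iff)
      then show ?thesis using less.prems(2)[OF e] V sep[of x y] sep[of y x] e
        by (auto simp: insert_commute)
    qed
    ultimately show ?thesis using one_page_glue[OF fin disj] V by blast
  next
    case False
    show ?thesis
    proof (cases "E = {}")
      case True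
      obtain f :: "'a \<Rightarrow> nat" where "inj_on f V"
        using less.prems(1) finite_imp_inj_to_nat_seg by metis
      then show ?thesis using True by (auto simp: one_page_def noncrossing_def)
    next
      case E: False
      obtain x A where "cycle E x A" "set (x # A) = V"
        using hamiltonian_cycle[OF less.prems(1,2) E False less.prems(3)] by blast
      then show ?thesis using less.prems(2,4) by (intro one_page_cycle) auto
    qed
  qed
qed

section \<open>Reducible vertices and colouring\<close>

text \<open>Call an interval closed if no edge leaves it from its interior; positions 0 and \<open>n + 1\<close> are
  virtual, so that \<open>{0..n + 1}\<close> is closed. Around the left end of a shortest closed interval with at
  least two interior positions, every edge has length at most 2.\<close>

lemma reducible_positions:
  fixes R :: "nat \<Rightarrow> nat \<Rightarrow> bool"
  assumes sym: "\<And>i j. R i j \<Longrightarrow> R j i"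
    and irrefl: "\<And>i. \<not> R i i"
    and range: "\<And>i j. R i j \<Longrightarrow> 1 \<le> i \<and> i \<le> n"
    and nc: "\<And>a b c d. R a c \<Longrightarrow> R b d \<Longrightarrow> a < b \<Longrightarrow> b < c \<Longrightarrow> c < d \<Longrightarrow> False"
    and "n \<ge> 1"
  shows "\<exists>u v w. 1 \<le> u \<and> u \<le> n \<and> 1 \<le> v \<and> v \<le> n \<and> (\<forall>x. R u x \<longrightarrow> x = v \<or> x = w) \<and>
    (\<forall>x y. R v x \<longrightarrow> R v y \<longrightarrow> x \<notin> {u, w} \<longrightarrow> y \<notin> {u, w} \<longrightarrow> x \<noteq> y \<longrightarrow> R x y)"
proof (cases "n = 1")
  case True
  then have "\<not> R i j" for i j using range[of i j] range[of j i] sym[of i j] irrefl[of 1]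
    by (metis le_antisym)
  then show ?thesis using \<open>n \<ge> 1\<close> by blast
next
  case False
  \<comment> \<open>\<open>a + 3 \<le> b\<close> provides two interior positions; the whole range
    \<open>{0..n + 1}\<close> qualifies because \<open>n\<close> is at least 2 here.\<close>
  define cl where "cl = (\<lambda>a b. a + 3 \<le> b \<and> b \<le> n + 1 \<and>
    (\<forall>x y. a < x \<longrightarrow> x < b \<longrightarrow> R x y \<longrightarrow> a \<le> y \<and> y \<le> b))"
  have "y \<le> n + 1" if "R x y" for x y using range[OF sym[OF that]] by simp
  then have "cl 0 (n + 1)" using False \<open>n \<ge> 1\<close> by (auto simp: cl_def)
  then have "\<exists>m a b. cl a b \<and> b - a = m" by blast
  then obtain m where "\<exists>a b. cl a b \<and> b - a = m"
    and least: "\<And>m'. m' < m \<Longrightarrow> \<not> (\<exists>a b. cl a b \<and> b - a = m')"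
    using exists_least_iff[of "\<lambda>m. \<exists>a b. cl a b \<and> b - a = m"] by blast
  then obtain a b where ab: "cl a b" and min: "\<And>a' b'. cl a' b' \<Longrightarrow> b - a \<le> b' - a'"
    by (metis not_le)
  have a3: "a + 3 \<le> b" and b: "b \<le> n + 1"
    and inner: "\<And>x y. a < x \<Longrightarrow> x < b \<Longrightarrow> R x y \<Longrightarrow> a \<le> y \<and> y \<le> b"
    using ab unfolding cl_def by auto
  \<comment> \<open>No edge leaves the span of a longer edge from its interior without crossing it,
    so this span would be a closed interval shorter than the chosen one.\<close>
  have short: "y \<le> x + 2" if "R x y" "a \<le> x" "x < y" "y \<le> b" "\<not> (x = a \<and> y = b)" for x y
  proof (rule ccontr)
    assume "\<not> y \<le> x + 2"
    then have "cl x y"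
      unfolding cl_def using that b nc sym by (smt (verit) leI le_trans Suc_leI add_Suc_right not_less_eq_eq numeral_2_eq_2 numeral_3_eq_3 add_2_eq_Suc' add.right_neutral)
    then show False using min[of x y] that a3 by linarith
  qed
  have near: "a \<le> y \<and> y \<le> b \<and> x \<le> y + 2 \<and> y \<le> x + 2 \<and> x \<noteq> y" if "R x y" "a < x" "x < b" for x y
    using inner[OF that(2,3,1)] short[of x y] short[of y x] sym[OF that(1)] irrefl[of x] that
    by (metis le_add1 le_trans less_imp_le linorder_neqE_nat not_less)
  show ?thesis
  proof (cases "R (a + 1) (a + 3)")
    case True
    \<comment> \<open>The edge from \<open>a + 1\<close> to \<open>a + 3\<close> encloses
      \<open>a + 2\<close>, whose other candidates for neighbours, \<open>a\<close> and
      \<open>a + 4\<close>, would require a crossing.\<close>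
    have "x = a + 1 \<or> x = a + 3" if "R (a + 2) x" for x
      using near[OF that] nc[OF True, of "a + 2" "a + 4"] nc[of a "a + 2" "a + 1" "a + 3"] True that
        sym[OF that] a3 by (cases "x = a"; cases "x = a + 4") auto
    moreover have "x = a \<or> x \<in> {a + 2, a + 3}" if "R (a + 1) x" for x
      using near[OF that] a3 by auto
    ultimately show ?thesis
      using a3 b by (intro exI[of _ "a + 2"] exI[of _ "a + 1"] exI[of _ "a + 3"]) auto
  next
    case F: False
    \<comment> \<open>Now \<open>a + 1\<close>, \<open>a + 2\<close>, \<open>a\<close> can serve as
      \<open>u\<close>, \<open>v\<close>, \<open>w\<close>, unless \<open>a + 3\<close> and
      \<open>a + 4\<close> are nonadjacent neighbours of \<open>a + 2\<close>.\<close>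
    have u: "x = a \<or> x = a + 2" if "R (a + 1) x" for x
      using near[OF that] a3 F that by (cases "x = a + 3") auto
    have v: "x = a \<or> x = a + 1 \<or> x = a + 3 \<or> x = a + 4" if "R (a + 2) x" for x
      using near[OF that] a3 by auto
    show ?thesis
    proof (cases "R (a + 2) (a + 3) \<and> R (a + 2) (a + 4) \<and> \<not> R (a + 3) (a + 4)")
      case True
      have "a + 4 \<le> b" using near[of "a + 2" "a + 4"] True a3 by auto
      \<comment> \<open>The edge from \<open>a + 2\<close> to \<open>a + 4\<close> encloses
        \<open>a + 3\<close>, which is left with \<open>a + 2\<close> as its only possible neighbour
        and serves as both \<open>u\<close> and \<open>v\<close>.\<close>
      then have "x = a + 2" if "R (a + 3) x" for x
        using near[OF that] nc[of "a + 2" "a + 4" "a + 3" "a + 5"] True that F sym[OF that]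
        by (cases "x = a + 1"; cases "x = a + 4"; cases "x = a + 5") auto
      then show ?thesis
        using \<open>a + 4 \<le> b\<close> b by (intro exI[of _ "a + 3"] exI[of _ "a + 3"] exI[of _ "a + 2"]) auto
    next
      case False
      have "R x y" if "R (a + 2) x" "R (a + 2) y" "x \<notin> {a + 1, a}" "y \<notin> {a + 1, a}" "x \<noteq> y" for x y
        using v[OF that(1)] v[OF that(2)] that False sym by auto
      then show ?thesis
        using u a3 b by (intro exI[of _ "a + 1"] exI[of _ "a + 2"] exI[of _ a]) auto
    qed
  qed
qed

text \<open>A colour of \<open>u\<close> other than that of \<open>w\<close> occurs at most once more around \<open>v\<close>, because the
  remaining neighbours of \<open>v\<close> form a clique. The case \<open>v = u\<close> covers vertices of degree at most 1.\<close>

definition reducible :: "'a set \<Rightarrow> 'a set set \<Rightarrow> 'a \<Rightarrow> 'a \<Rightarrow> 'a \<Rightarrow> bool" where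
  "reducible V E u v w \<longleftrightarrow> u \<in> V \<and> neighbourhood E u \<subseteq> {v, w} \<and>
     (\<forall>x\<in>neighbourhood E v - {u, w}. \<forall>y\<in>neighbourhood E v - {u, w}. x \<noteq> y \<longrightarrow> {x, y} \<in> E)"

text \<open>Vertices are replaced by their ranks in the order \<open>f\<close>, and the result on
  positions is carried back.\<close>

lemma reducible_exists:
  assumes G: "fin_simple_graph V E" and "one_page V E" and "V \<noteq> {}"
  obtains u v w where "reducible V E u v w"
proof -
  obtain f :: "'a \<Rightarrow> nat" where f: "inj_on f V" and nc: "noncrossing f E"
    using assms(2) by (auto simp: one_page_def)
  have fin: "finite V" and EV: "\<And>x y. {x, y} \<in> E \<Longrightarrow> x \<in> V \<and> y \<in> V \<and> x \<noteq> y"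
    using G by (auto simp: fin_simple_graph_def dest!: bspec)
  define n where "n = card V"
  have n: "card (f ` V) = n" using f by (simp add: n_def card_image)
  obtain h where h: "bij_betw h {..<n} (f ` V)" "strict_mono_on {..<n} h"
    using ex_bij_betw_strict_mono_card[of "f ` V"] fin n by auto
  \<comment> \<open>\<open>h\<close> counts from 0 and positions count from 1, so that 0 and
    \<open>n + 1\<close> remain virtual.\<close>
  define q where "q i = inv_into V f (h (i - 1))" for i
  have q: "q i \<in> V" "f (q i) = h (i - 1)" if "1 \<le> i" "i \<le> n" for i
  proof -
    have "h (i - 1) \<in> f ` V" using h(1) that by (intro bij_betw_apply[of h "{..<n}"]) auto
    then show "q i \<in> V" "f (q i) = h (i - 1)" unfolding q_def by (auto intro: inv_into_into f_inv_into_f)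
  qed
  have surj: "\<exists>i. 1 \<le> i \<and> i \<le> n \<and> q i = x" if x: "x \<in> V" for x
  proof -
    have "f x \<in> h ` {..<n}" using h(1) x by (simp add: bij_betw_def)
    then obtain i where "i < n" "h i = f x" by auto
    then have "q (Suc i) = x" using f x by (simp add: q_def)
    then show ?thesis using \<open>i < n\<close> by (intro exI[of _ "Suc i"]) simp
  qed
  have less: "f (q i) < f (q j)" if "1 \<le> i" "j \<le> n" "i < j" for i j
    using q(2)[of i] q(2)[of j] that strict_mono_onD[OF h(2), of "i - 1" "j - 1"] by auto
  define R where "R i j \<longleftrightarrow> 1 \<le> i \<and> i \<le> n \<and> 1 \<le> j \<and> j \<le> n \<and> {q i, q j} \<in> E" for i j
  have "\<exists>u v w. 1 \<le> u \<and> u \<le> n \<and> 1 \<le> v \<and> v \<le> n \<and> (\<forall>x. R u x \<longrightarrow> x = v \<or> x = w) \<and>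
    (\<forall>x y. R v x \<longrightarrow> R v y \<longrightarrow> x \<notin> {u, w} \<longrightarrow> y \<notin> {u, w} \<longrightarrow> x \<noteq> y \<longrightarrow> R x y)"
  proof (rule reducible_positions)
    show "R j i" if "R i j" for i j using that by (simp add: R_def insert_commute)
    show "\<not> R i i" for i using EV[of "q i" "q i"] by (auto simp: R_def)
    show "1 \<le> i \<and> i \<le> n" if "R i j" for i j using that by (simp add: R_def)
    show False if "R a c" "R b d" "a < b" "b < c" "c < d" for a b c d
      using noncrossingD[OF nc, of "q a" "q c" "q b" "q d"] that less unfolding R_def by auto
    show "1 \<le> n" using \<open>V \<noteq> {}\<close> fin by (simp add: n_def Suc_le_eq card_gt_0_iff)
  qed
  then obtain u v w where uv: "1 \<le> u" "u \<le> n" "1 \<le> v" "v \<le> n"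
    and u: "\<And>x. R u x \<Longrightarrow> x = v \<or> x = w"
    and v: "\<And>x y. R v x \<Longrightarrow> R v y \<Longrightarrow> x \<notin> {u, w} \<Longrightarrow> y \<notin> {u, w} \<Longrightarrow> x \<noteq> y \<Longrightarrow> R x y"
    by metis
  have pos: "\<exists>j. R i j \<and> q j = x" if "x \<in> neighbourhood E (q i)" "1 \<le> i" "i \<le> n" for x i
  proof -
    have E: "{q i, x} \<in> E" using that by (simp add: neighbourhood_def insert_commute)
    then obtain j where "1 \<le> j" "j \<le> n" "q j = x" using surj EV by metis
    then show ?thesis using E that unfolding R_def by blast
  qed
  \<comment> \<open>The position \<open>w\<close> may be virtual. Then \<open>R u w\<close> fails,
    and any value of \<open>q w\<close> will do: it can only relax the two conditions.\<close>
  have "reducible V E (q u) (q v) (q w)"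
    unfolding reducible_def
  proof (intro conjI ballI impI)
    show "q u \<in> V" using q uv by blast
    show "neighbourhood E (q u) \<subseteq> {q v, q w}" using pos[OF _ uv(1,2)] u by blast
    fix x y
    assume x: "x \<in> neighbourhood E (q v) - {q u, q w}" and y: "y \<in> neighbourhood E (q v) - {q u, q w}"
      and "x \<noteq> y"
    obtain i j where "R v i" "q i = x" "R v j" "q j = y" using pos[OF _ uv(3,4)] x y by blast
    moreover from this have "i \<notin> {u, w}" "j \<notin> {u, w}" "i \<noteq> j" using x y \<open>x \<noteq> y\<close> by auto
    ultimately have "R i j" using v by blast
    then show "{x, y} \<in> E" using \<open>q i = x\<close> \<open>q j = y\<close> by (simp add: R_def)
  qed
  then show ?thesis using that by blast
qed

section \<open>Greedy extension of frugal colourings\<close>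

text \<open>The classes of the frequent colours are disjoint subsets of \<open>N\<close> with at
  least \<open>k\<close> elements each; \<open>k \<ge> 1\<close> makes them nonempty.\<close>

lemma card_frequent_colours:
  assumes "finite N" "k \<ge> 1"
  shows "finite {a. k \<le> card {x \<in> N. c x = a}}"
    and "k * card {a. k \<le> card {x \<in> N. c x = a}} \<le> card N"
proof -
  let ?F = "{a. k \<le> card {x \<in> N. c x = a}}"
  have "?F \<subseteq> c ` N"
  proof
    fix a assume "a \<in> ?F"
    then have "{x \<in> N. c x = a} \<noteq> {}" using \<open>k \<ge> 1\<close> by (metis card.empty mem_Collect_eq not_one_le_zero le_trans)
    then show "a \<in> c ` N" by blast
  qed
  then show fin: "finite ?F" using assms(1) finite_surj by blast
  have "k * card ?F = (\<Sum>a\<in>?F. k)" by simp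
  also have "\<dots> \<le> (\<Sum>a\<in>?F. card {x \<in> N. c x = a})" by (intro sum_mono) simp
  also have "\<dots> = card (\<Union>a\<in>?F. {x \<in> N. c x = a})"
    using fin assms(1) by (intro card_UN_disjoint[symmetric]) auto
  also have "\<dots> \<le> card N" using assms(1) by (intro card_mono) auto
  finally show "k * card ?F \<le> card N" .
qed

lemma neighbourhood_delete:
  "u \<noteq> x \<Longrightarrow> neighbourhood {e \<in> E. u \<notin> e} x = neighbourhood E x - {u}"
  by (auto simp: neighbourhood_def)

lemma finite_neighbourhood:
  assumes "fin_simple_graph V E"
  shows "finite (neighbourhood E x)"
proof -
  have "neighbourhood E x \<subseteq> V" using assms by (auto simp: neighbourhood_def fin_simple_graph_def)
  then show ?thesis using assms finite_subset by (auto simp: fin_simple_graph_def)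
qed

text \<open>Colouring \<open>u\<close> adds to the counts only around its neighbours, which are
  among \<open>v\<close> and \<open>w\<close>. Around \<open>w\<close> the last assumption leaves
  room, around \<open>v\<close> the clique does. Around \<open>u\<close> there are at most two
  vertices to count, and \<open>k \<ge> 2\<close>.\<close>

lemma extend_frugal_colouring:
  assumes G: "fin_simple_graph V E" and "k \<ge> 2" and red: "reducible V E u v w"
    and c: "frugal_colouring k (V - {u}) {e \<in> E. u \<notin> e} c"
    and \<alpha>: "\<alpha> \<noteq> c v" "\<alpha> \<noteq> c w"
      "{u, w} \<in> E \<Longrightarrow> card {x \<in> neighbourhood E w - {u}. c x = \<alpha>} < k"
  shows "frugal_colouring k V E (c(u := \<alpha>))"
  unfolding frugal_colouring_def
proof (intro conjI allI ballI impI)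
  let ?c = "c(u := \<alpha>)"
  have ne: "x \<noteq> y" if "{x, y} \<in> E" for x y using G that by (auto simp: fin_simple_graph_def dest!: bspec)
  have u: "neighbourhood E u \<subseteq> {v, w}"
    and clique: "\<And>x y. x \<in> neighbourhood E v - {u, w} \<Longrightarrow> y \<in> neighbourhood E v - {u, w} \<Longrightarrow> x \<noteq> y \<Longrightarrow> {x, y} \<in> E"
    using red by (auto simp: reducible_def)
  have proper: "c x \<noteq> c y" if "{x, y} \<in> E" "x \<noteq> u" "y \<noteq> u" for x y
    using c that unfolding frugal_colouring_def by auto
  have new: "\<alpha> \<noteq> c x" if "{x, u} \<in> E" for x
    using u \<alpha>(1,2) that by (auto simp: neighbourhood_def)
  show "?c x \<noteq> ?c y" if "{x, y} \<in> E" for x y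
    using that new[of x] new[of y] proper[OF that] ne[OF that]
    by (cases "x = u"; cases "y = u") (auto simp: insert_commute)
  fix x a assume "x \<in> V"
  note fin = finite_neighbourhood[OF G]
  show "card {y \<in> neighbourhood E x. ?c y = a} \<le> k"
  proof (cases "x = u")
    case True
    have "card {y \<in> neighbourhood E x. ?c y = a} \<le> card {v, w}"
      using u True by (intro card_mono) auto
    also have "\<dots> \<le> 2" by (simp add: card_insert_if)
    finally show ?thesis using \<open>k \<ge> 2\<close> by simp
  next
    case False
    let ?T = "{y \<in> neighbourhood E x - {u}. c y = a}"
    have finT: "finite ?T" using fin by simp
    have "card {y \<in> neighbourhood {e \<in> E. u \<notin> e} x. c y = a} \<le> k"
      using c \<open>x \<in> V\<close> False unfolding frugal_colouring_def by blast
    then have T: "card ?T \<le> k" using False by (simp add: neighbourhood_delete)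
    show ?thesis
    proof (cases "u \<in> neighbourhood E x \<and> a = \<alpha>")
      case False
      then have "{y \<in> neighbourhood E x. ?c y = a} = ?T" by auto
      then show ?thesis using T by simp
    next
      case True
      then have "{y \<in> neighbourhood E x. ?c y = a} = insert u ?T" by auto
      then have card: "card {y \<in> neighbourhood E x. ?c y = a} = Suc (card ?T)" using finT by simp
      have ux: "{u, x} \<in> E" using True by (simp add: neighbourhood_def)
      then consider "x = w" | "x = v" using u by (auto simp: neighbourhood_def insert_commute)
      then show ?thesis
      proof cases
        case 1
        then show ?thesis using \<alpha>(3) ux True card by simp
      next
        case 2
        \<comment> \<open>Neighbours of \<open>v\<close> coloured \<alpha> differ from
          \<open>w\<close>, as \<alpha> is not \<open>c w\<close>. Two of them would be adjacent and
          share a colour.\<close>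
        have "y = z" if "y \<in> ?T" "z \<in> ?T" for y z
        proof (rule ccontr)
          assume "y \<noteq> z"
          moreover have "y \<in> neighbourhood E v - {u, w}" "z \<in> neighbourhood E v - {u, w}"
            using that 2 True \<alpha>(2) by auto
          ultimately have "{y, z} \<in> E" using clique by blast
          then show False using proper[of y z] that by simp
        qed
        then have "card ?T \<le> 1" using finT by (simp add: card_le_Suc0_iff_eq)
        then show ?thesis using card \<open>k \<ge> 2\<close> by simp
      qed
    qed
  qed
qed

text \<open>\<open>D\<close> is an upper bound and not the maximum degree itself, so it and the
  lists stay fixed while vertices are deleted.\<close>

lemma one_page_frugal_colouring:
  assumes "fin_simple_graph V E" "one_page V E" "k \<ge> 2" "D \<ge> 1" "\<forall>v\<in>V. degree E v \<le> D"
    and "\<forall>v\<in>V. finite (L v) \<and> (D - 1) div k + 3 \<le> card (L v)"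
  shows "\<exists>c. frugal_colouring k V E c \<and> (\<forall>v\<in>V. c v \<in> L v)"
  using assms
proof (induction "card V" arbitrary: V E rule: less_induct)
  case less
  note G = less.prems(1)
  show ?case
  proof (cases "V = {}")
    case True
    then have "E = {}" using G by (auto simp: fin_simple_graph_def)
    then show ?thesis using True by (simp add: frugal_colouring_def)
  next
    case False
    obtain u v w where red: "reducible V E u v w" using reducible_exists[OF G less.prems(2) False] .
    then have "u \<in> V" by (simp add: reducible_def)
    have fin: "finite V" using G by (simp add: fin_simple_graph_def)
    let ?E = "{e \<in> E. u \<notin> e}"
    have "\<exists>c. frugal_colouring k (V - {u}) ?E c \<and> (\<forall>v\<in>V - {u}. c v \<in> L v)"
    proof (rule less.hyps)
      show "card (V - {u}) < card V" using \<open>u \<in> V\<close> fin by (rule card_Diff1_less[rotated])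
      show "fin_simple_graph (V - {u}) ?E" using G by (auto simp: fin_simple_graph_def)
      obtain f :: "'a \<Rightarrow> nat" where f: "inj_on f V" "noncrossing f E"
        using less.prems(2) by (auto simp: one_page_def)
      from f(2) have "noncrossing f ?E" by (rule noncrossing_mono) blast
      moreover have "inj_on f (V - {u})" using f(1) by (rule inj_on_diff)
      ultimately show "one_page (V - {u}) ?E" unfolding one_page_def by blast
      show "\<forall>x\<in>V - {u}. degree ?E x \<le> D"
      proof
        fix x assume x: "x \<in> V - {u}"
        then have "degree ?E x \<le> degree E x"
          using finite_neighbourhood[OF G, of x] neighbourhood_delete[of u x E]
          unfolding degree_def by (auto intro: card_mono)
        then show "degree ?E x \<le> D" using less.prems(5) x by (meson DiffD1 le_trans)
      qed
    qed (use less.prems in auto)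
    then obtain c where c: "frugal_colouring k (V - {u}) ?E c" "\<forall>v\<in>V - {u}. c v \<in> L v" by blast
    let ?N = "neighbourhood E w - {u}"
    \<comment> \<open>The colours exhausted around \<open>w\<close>, which matter only if
      \<open>u\<close> is a neighbour of \<open>w\<close>. Then \<open>u\<close> is one of at most
      \<open>D\<close> neighbours, so \<open>D - 1\<close> others are left to count.\<close>
    define F where "F = (if {u, w} \<in> E then {a. k \<le> card {x \<in> ?N. c x = a}} else {})"
    have "finite ?N" using finite_neighbourhood[OF G] by simp
    note freq = card_frequent_colours[OF this, of k c]
    have "card F \<le> (D - 1) div k"
    proof (cases "{u, w} \<in> E")
      case True
      then have "u \<in> neighbourhood E w" "w \<in> V"
        using G by (auto simp: neighbourhood_def fin_simple_graph_def)
      then have "card ?N \<le> D - 1"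
        using less.prems(5) finite_neighbourhood[OF G, of w] by (auto simp: degree_def)
      then have "k * card F \<le> D - 1" using freq(2) True less.prems(3) by (simp add: F_def)
      then show ?thesis using less.prems(3) by (simp add: less_eq_div_iff_mult_less_eq mult.commute)
    qed (simp add: F_def)
    moreover have "finite F" using freq(1) less.prems(3) by (simp add: F_def)
    \<comment> \<open>At most \<open>(D - 1) div k + 2\<close> colours are forbidden, one less than
      the list is sure to hold.\<close>
    ultimately have "card ({c v, c w} \<union> F) < card (L u)" "finite ({c v, c w} \<union> F)"
      using card_Un_le[of "{c v, c w}" F] card_insert_le_m1[of 2 "{c w}" "c v"] less.prems(6) \<open>u \<in> V\<close>
      by fastforce+
    then have "\<not> L u \<subseteq> {c v, c w} \<union> F" using card_mono by (metis not_le)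
    then obtain \<alpha> where \<alpha>: "\<alpha> \<in> L u" "\<alpha> \<noteq> c v" "\<alpha> \<noteq> c w" "\<alpha> \<notin> F" by blast
    have "frugal_colouring k V E (c(u := \<alpha>))"
      using \<alpha>(2-4) by (intro extend_frugal_colouring[OF G less.prems(3) red c(1)]) (auto simp: F_def not_le)
    then show ?thesis using \<alpha>(1) c(2) by (intro exI[of _ "c(u := \<alpha>)"]) auto
  qed
qed

text \<open>With \<open>t\<close> the choice number and all lists equal to \<open>{1..t}\<close>, a
  list colouring uses at most \<open>t\<close> colours.\<close>

lemma frugal_chromatic_le_choice:
  assumes G: "fin_simple_graph V E" and "k \<ge> 1"
  shows "frugal_chromatic_number k V E \<le> frugal_choice_number k V E"
proof -
  let ?t = "frugal_choice_number k V E"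
  have "frugal_choosable k V E ?t"
    unfolding frugal_choice_number_def by (rule LeastI) (rule frugal_choosable_card[OF assms])
  moreover have "list_assignment ?t V (\<lambda>_. {1..int ?t})" by (simp add: list_assignment_def)
  ultimately obtain c where c: "frugal_colouring k V E c" "\<forall>v\<in>V. c v \<in> {1..int ?t}"
    unfolding frugal_choosable_def by blast
  have "frugal_chromatic_number k V E \<le> card (c ` V)"
    unfolding frugal_chromatic_number_def using c(1) by (intro Least_le) blast
  also have "\<dots> \<le> card {1..int ?t}" using c(2) by (intro card_mono) auto
  finally show ?thesis by simp
qed

theorem theorem12:
  fixes V :: "'a set" and E :: "'a set set" and k :: nat
  assumes "k \<ge> 2"
    and "fin_simple_graph V E"
    and "outerplanar V E"
    and "max_degree V E \<ge> 3"
  shows "frugal_chromatic_number k V E \<le> frugal_choice_number k V E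
    \<and> frugal_choice_number k V E \<le> (max_degree V E - 1) div k + 3"
proof
  show "frugal_chromatic_number k V E \<le> frugal_choice_number k V E"
    using assms by (intro frugal_chromatic_le_choice) auto
  let ?D = "max_degree V E"
  have fin: "finite V" and E: "\<And>e. e \<in> E \<Longrightarrow> e \<subseteq> V \<and> card e = 2"
    using assms(2) by (auto simp: fin_simple_graph_def)
  obtain p \<gamma> where "outerplane_drawing V E p \<gamma>"
    using assms(2,3) unfolding outerplanar_def outerplane_drawing_def by blast
  then have "one_page V E"
    using one_page_if_free[OF fin E] outerplane_drawing.theta_free outerplane_drawing.crossing_free
    by blast
  moreover have "\<forall>v\<in>V. degree E v \<le> ?D"
    using fin by (auto simp: max_degree_def intro!: Max_ge)
  ultimately have "frugal_choosable k V E ((?D - 1) div k + 3)"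
    unfolding frugal_choosable_def list_assignment_def
    using one_page_frugal_colouring[OF assms(2) _ assms(1), of ?D] assms(4) by auto
  then show "frugal_choice_number k V E \<le> (?D - 1) div k + 3"
    unfolding frugal_choice_number_def by (rule Least_le)
qed

end
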